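(* Let $g(z)=\sum_{n=0}^\infty b_n z^n$ be a nonconstant power series with nonnegative coefficients $b_n\ge 0$ and radius of convergence $R\in(0,\infty]$, and let $h\colon [0,R)\to(0,\pi)$ be a function. Put $f=e^g$ and, for $t\in(0,R)$, \[ \sigma^2(t)=t g'(t)+t^2 g''(t)=\sum_{n\ge1} n^2 b_n t^n,\qquad \omega_g(t)=\tfrac16\Big(b_1 t+8 b_2 t^2+\tfrac92\, t^3 g'''(t)\Big). \] Assume that (i) $\lim_{t\uparrow R}\big(t g'(t)+t^2 g''(t)\big)=+\infty$; (ii) $\lim_{t\uparrow R}\omega_g(t)\,h(t)^3=0$; (iii) there exist $t_0\in(0,R)$ and functions $U\colon (t_0,R)\to(0,\pi]$ and $V\colon(t_0,R)\to(0,\infty)$ such that \[ \sup_{\omega\le|\theta|\le\pi}\big(\Re g(te^{i\theta})-g(t)\big)\le -V(t)\,\omega^2\quad\text{for all } t\in(t_0,R)\text{ and all } 0\le \omega\le U(t); \] (iv) $h(t)\le U(t)$ for all $t\in(t_0,R)$, and $\lim_{t\uparrow R}\sigma(t)\,e^{-V(t)h(t)^2}=0$. Then $f=e^g$ is in the Hayman class.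
   Context: For a nonconstant power series $f(z)=\sum_{n\ge0}a_nz^n$ with $a_n\ge0$, $a_0>0$ and radius of convergence $R>0$, its Khinchin family is the family of random variables $(X_t)_{t\in[0,R)}$ with values in $\{0,1,2,\dots\}$ given by $\mathbb P(X_t=n)=a_nt^n/f(t)$ for $t\in(0,R)$ (and $X_0\equiv0$). Write $m(t)=\mathbb E(X_t)=tf'(t)/f(t)$, $\sigma^2(t)=\mathbb V(X_t)=tm'(t)$, and $\breve X_t=(X_t-m(t))/\sigma(t)$ for $t\in(0,R)$. (For $f=e^g$ one has $\sigma^2(t)=tg'(t)+t^2g''(t)$.) Such an $f$ is in the Hayman class if there is a function $h\colon[0,R)\to(0,\pi]$ such that: $\lim_{t\uparrow R}\sup_{|\theta|\le h(t)\sigma(t)}\big|\mathbb E(e^{i\theta\breve X_t})e^{\theta^2/2}-1\big|=0$; $\lim_{t\uparrow R}\sigma(t)\sup_{h(t)\sigma(t)\le|\theta|\le\pi\sigma(t)}|\mathbb E(e^{i\theta\breve X_t})|=0$; and $\lim_{t\uparrow R}\sigma(t)=\infty$. *)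

theory Defs
  imports "HOL-Probability.Probability"
begin

definition power_series :: "(nat \<Rightarrow> real) \<Rightarrow> 'a::real_normed_algebra_1 \<Rightarrow> 'a" where
  "power_series a z = (\<Sum>n. a n *\<^sub>R z ^ n)"

text \<open>The filter \<open>t \<up> R\<close> on the reals, for an extended real \<open>R\<close>.\<close>

definition at_upto :: "ereal \<Rightarrow> real filter" where
  "at_upto R = filtercomap ereal (at_left R)"

lemma filtercomap_filtermap_ereal: "filtercomap ereal (filtermap ereal F) = F"
proof (rule antisym)
  show "filtercomap ereal (filtermap ereal F) \<le> F"
  proof (rule filter_leI)
    fix P assume P: "eventually P F"
    have "eventually (\<lambda>x. P (real_of_ereal x)) (filtermap ereal F)"
      using P by (simp add: eventually_filtermap)
    then show "eventually P (filtercomap ereal (filtermap ereal F))"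
      unfolding eventually_filtercomap
      by (intro exI[of _ "\<lambda>x. P (real_of_ereal x)"]) simp
  qed
qed (rule filtercomap_filtermap)

lemma at_upto_ereal: "at_upto (ereal r) = at_left r"
  by (simp add: at_upto_def at_left_ereal filtercomap_filtermap_ereal)

lemma at_upto_infinity: "at_upto \<infinity> = at_top"
  by (simp add: at_upto_def at_left_PInf filtercomap_filtermap_ereal)


text \<open>The law of \<open>X\<^sub>t\<close>. For \<open>t = 0\<close> the convention \<open>0 ^ 0 = 1\<close> yields the point mass at \<open>0\<close>.\<close>

definition khinchin :: "(nat \<Rightarrow> real) \<Rightarrow> real \<Rightarrow> nat pmf" where
  "khinchin a t = embed_pmf (\<lambda>n. a n * t ^ n / power_series a t)"

definition khinchin_mean :: "(nat \<Rightarrow> real) \<Rightarrow> real \<Rightarrow> real" where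
  "khinchin_mean a t = measure_pmf.expectation (khinchin a t) real"

definition khinchin_sd :: "(nat \<Rightarrow> real) \<Rightarrow> real \<Rightarrow> real" where
  "khinchin_sd a t = sqrt (measure_pmf.variance (khinchin a t) real)"

text \<open>The characteristic function of the normalized variable \<open>(X\<^sub>t - m(t)) / \<sigma>(t)\<close>.\<close>

definition khinchin_char :: "(nat \<Rightarrow> real) \<Rightarrow> real \<Rightarrow> real \<Rightarrow> complex" where
  "khinchin_char a t \<theta> =
     measure_pmf.expectation (khinchin a t)
       (\<lambda>n. exp (\<i> * of_real (\<theta> * ((real n - khinchin_mean a t) / khinchin_sd a t))))"

definition khinchin_series :: "(nat \<Rightarrow> real) \<Rightarrow> bool" where
  "khinchin_series a \<longleftrightarrow>
     (\<forall>n. a n \<ge> 0) \<and> a 0 > 0 \<and> (\<exists>n\<ge>1. a n \<noteq> 0) \<and> conv_radius a > 0"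

definition hayman_coeffs :: "(nat \<Rightarrow> real) \<Rightarrow> bool" where
  "hayman_coeffs a \<longleftrightarrow> khinchin_series a \<and>
     (\<exists>h :: real \<Rightarrow> real.
        (\<forall>t\<ge>0. ereal t < conv_radius a \<longrightarrow> 0 < h t \<and> h t \<le> pi) \<and>
        ((\<lambda>t. SUP \<theta>\<in>{\<theta>. \<bar>\<theta>\<bar> \<le> h t * khinchin_sd a t}.
                cmod (khinchin_char a t \<theta> * of_real (exp (\<theta>\<^sup>2 / 2)) - 1))
           \<longlongrightarrow> 0) (at_upto (conv_radius a)) \<and>
        ((\<lambda>t. khinchin_sd a t *
               (SUP \<theta>\<in>{\<theta>. h t * khinchin_sd a t \<le> \<bar>\<theta>\<bar> \<and> \<bar>\<theta>\<bar> \<le> pi * khinchin_sd a t}.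
                  cmod (khinchin_char a t \<theta>)))
           \<longlongrightarrow> 0) (at_upto (conv_radius a)) \<and>
        filterlim (khinchin_sd a) at_top (at_upto (conv_radius a)))"

text \<open>A function \<open>f\<close> is identified with its (necessarily unique) power series at \<open>0\<close>;
  only its values on the disc of convergence matter.\<close>

definition hayman_class :: "(complex \<Rightarrow> complex) \<Rightarrow> bool" where
  "hayman_class f \<longleftrightarrow>
     (\<exists>a. hayman_coeffs a \<and> (\<forall>z. ereal (cmod z) < conv_radius a \<longrightarrow> f z = power_series a z))"


text \<open>\<open>\<sigma>\<^sup>2(t)\<close> and \<open>\<omega>\<^sub>g(t)\<close> for the power series \<open>g\<close> with coefficients \<open>b\<close>.\<close>

definition sigma_sq :: "(nat \<Rightarrow> real) \<Rightarrow> real \<Rightarrow> real" where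
  "sigma_sq b t =
     t * deriv (power_series b) t + t\<^sup>2 * (deriv ^^ 2) (power_series b) t"

definition omega :: "(nat \<Rightarrow> real) \<Rightarrow> real \<Rightarrow> real" where
  "omega b t =
     1 / 6 * (b 1 * t + 8 * b 2 * t\<^sup>2 + 9 / 2 * t ^ 3 * (deriv ^^ 3) (power_series b) t)"


lemma khinchin_series_summable:
  assumes "ereal \<bar>t\<bar> < conv_radius a"
  shows "summable (\<lambda>n. a n * t ^ n)"
  using summable_in_conv_radius[of t a] assms by simp

lemma pmf_khinchin:
  assumes a: "khinchin_series a" and t: "0 \<le> t" "ereal t < conv_radius a"
  shows "pmf (khinchin a t) n = a n * t ^ n / power_series a t"
proof -
  have nn: "a n * t ^ n \<ge> 0" for n
    using a t by (simp add: khinchin_series_def)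
  have sm: "summable (\<lambda>n. a n * t ^ n)"
    using t by (intro khinchin_series_summable) simp
  have "(\<Sum>n\<in>{0}. a n * t ^ n) \<le> (\<Sum>n. a n * t ^ n)"
    by (rule sum_le_suminf[OF sm]) (use nn in auto)
  then have pos: "power_series a t > 0"
    using a by (simp add: power_series_def khinchin_series_def)
  have "(\<lambda>n. a n * t ^ n / power_series a t) sums (power_series a t / power_series a t)"
    using sm by (intro sums_divide) (simp add: power_series_def summable_sums)
  then have s: "(\<lambda>n. a n * t ^ n / power_series a t) sums 1"
    using pos by simp
  have "(\<integral>\<^sup>+n. ennreal (a n * t ^ n / power_series a t) \<partial>count_space UNIV)
      = (\<Sum>n. ennreal (a n * t ^ n / power_series a t))"
    by (rule nn_integral_count_space_nat)
  also have "\<dots> = ennreal 1"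
    using s nn pos by (intro suminf_ennreal_eq) auto
  finally have 1: "(\<integral>\<^sup>+n. ennreal (a n * t ^ n / power_series a t) \<partial>count_space UNIV) = 1"
    by simp
  show ?thesis
    unfolding khinchin_def using nn pos 1 by (intro pmf_embed_pmf) auto
qed

lemma power_series_DERIV:
  assumes "ereal \<bar>t\<bar> < conv_radius b"
  shows "(power_series b has_real_derivative power_series (diffs b) t) (at t)"
    and "ereal \<bar>t\<bar> < conv_radius (diffs b)"
proof -
  obtain K where K: "ereal \<bar>t\<bar> < ereal K" "ereal K < conv_radius b"
    using assms by (meson ereal_dense2)
  then have K0: "\<bar>t\<bar> < K" "K > 0" by auto
  have "summable (\<lambda>n. b n * K ^ n)"
    using K K0 by (intro khinchin_series_summable) simp
  then show "(power_series b has_real_derivative power_series (diffs b) t) (at t)"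
    unfolding power_series_def using K0 by (simp add: termdiffs_strong)
  obtain L where L: "\<bar>t\<bar> < L" "L < K" using K0 dense by blast
  have "summable (\<lambda>n. diffs b n * L ^ n)"
    by (rule termdiff_converges[of _ K])
       (use L in \<open>auto intro!: khinchin_series_summable order_less_trans[OF _ K(2)]\<close>)
  then have "ereal (norm L) \<le> conv_radius (diffs b)"
    by (rule conv_radius_geI)
  then show "ereal \<bar>t\<bar> < conv_radius (diffs b)"
    using L by (metis abs_ge_zero ereal_less_eq(3) less_le_trans less_ereal.simps(1) abs_of_pos order_le_less_trans real_norm_def)
qed

lemma sigma_sq_sums:
  assumes "ereal \<bar>t\<bar> < conv_radius b"
  shows "(\<lambda>n. (real n)\<^sup>2 * b n * t ^ n) sums sigma_sq b t"
proof -
  have ev: "eventually (\<lambda>x. ereal \<bar>x\<bar> < conv_radius b) (nhds t)"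
  proof -
    obtain K where K: "ereal \<bar>t\<bar> < ereal K" "ereal K < conv_radius b"
      using assms by (meson ereal_dense2)
    then have "eventually (\<lambda>x. x \<in> {-K<..<K}) (nhds t)"
      by (intro eventually_nhds_in_open) auto
    then show ?thesis
    proof eventually_elim
      case (elim x)
      then have "ereal \<bar>x\<bar> < ereal K" by auto
      with K(2) show ?case by (rule less_trans[rotated])
    qed
  qed
  have d1: "deriv (power_series b) t = power_series (diffs b) t"
    by (intro DERIV_imp_deriv power_series_DERIV assms)
  have "eventually (\<lambda>x. deriv (power_series b) x = power_series (diffs b) x) (nhds t)"
    using ev by eventually_elim (intro DERIV_imp_deriv power_series_DERIV)
  then have "deriv (deriv (power_series b)) t = deriv (power_series (diffs b)) t"
    by (rule deriv_cong_ev) simp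
  also have "\<dots> = power_series (diffs (diffs b)) t"
    by (intro DERIV_imp_deriv power_series_DERIV assms)
  finally have d2: "(deriv ^^ 2) (power_series b) t = power_series (diffs (diffs b)) t"
    by (simp add: numeral_2_eq_2)
  note r = power_series_DERIV(2)[OF assms]
  have s1: "(\<lambda>n. diffs b n * t ^ n) sums power_series (diffs b) t"
    using khinchin_series_summable[OF r] by (simp add: power_series_def summable_sums)
  have s2: "(\<lambda>n. diffs (diffs b) n * t ^ n) sums power_series (diffs (diffs b)) t"
    using khinchin_series_summable[OF power_series_DERIV(2)[OF r]]
    by (simp add: power_series_def summable_sums)
  have "(\<lambda>n. t * (diffs b n * t ^ n)) sums (t * power_series (diffs b) t)"
    using s1 by (rule sums_mult)
  then have "(\<lambda>n. real (Suc n) * b (Suc n) * t ^ Suc n) sums (t * power_series (diffs b) t)"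
    by (simp add: diffs_def mult_ac)
  then have A: "(\<lambda>n. real n * b n * t ^ n) sums (t * power_series (diffs b) t)"
    by (subst (asm) sums_Suc_iff) simp
  have "(\<lambda>n. t\<^sup>2 * (diffs (diffs b) n * t ^ n)) sums (t\<^sup>2 * power_series (diffs (diffs b)) t)"
    using s2 by (rule sums_mult)
  then have "(\<lambda>n. real (Suc (Suc n)) * (real (Suc (Suc n)) - 1) * b (Suc (Suc n)) * t ^ Suc (Suc n))
      sums (t\<^sup>2 * power_series (diffs (diffs b)) t)"
    by (simp add: diffs_def mult_ac power2_eq_square add_ac)
  then have "(\<lambda>n. real (Suc n) * (real (Suc n) - 1) * b (Suc n) * t ^ Suc n)
      sums (t\<^sup>2 * power_series (diffs (diffs b)) t)"
    by (subst (asm) sums_Suc_iff) simp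
  then have B: "(\<lambda>n. real n * (real n - 1) * b n * t ^ n)
      sums (t\<^sup>2 * power_series (diffs (diffs b)) t)"
    by (subst (asm) sums_Suc_iff) simp
  have eq: "real n * b n * t ^ n + real n * (real n - 1) * b n * t ^ n = (real n)\<^sup>2 * b n * t ^ n"
    for n by (simp add: algebra_simps power2_eq_square)
  show ?thesis
    using sums_add[OF A B] unfolding sigma_sq_def d1 d2 eq .
qed

end

theory Submission
  imports Defs "HOL-Complex_Analysis.Complex_Analysis"
begin

text \<open>
  With \<open>\<phi> = \<theta> / \<sigma>(t)\<close>, the characteristic function of the normalized variable is
  \<open>exp (g(t e\<^bsup>i\<phi>\<^esup>) - g(t) - i \<phi> t g'(t))\<close>. Expanding the exponent termwise to second order in \<open>\<phi>\<close>,
  the quadratic term is exactly \<open>-\<theta>\<^sup>2/2\<close>, and the remainder is at most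
  \<open>\<bar>\<phi>\<bar>\<^sup>3/6 \<Sum> n\<^sup>3 b\<^sub>n t\<^sup>n \<le> \<omega>\<^sub>g(t) \<bar>\<phi>\<bar>\<^sup>3\<close>, which tends to \<open>0\<close> uniformly on \<open>\<bar>\<phi>\<bar> \<le> h(t)\<close>. On \<open>\<bar>\<phi>\<bar> \<ge> h(t)\<close>
  the modulus is \<open>exp (Re g(t e\<^bsup>i\<phi>\<^esup>) - g(t))\<close>, which condition (iii) at \<open>\<omega> = h(t)\<close>
  bounds by \<open>exp (-V(t) h(t)\<^sup>2)\<close>.
\<close>

section \<open>Power series on the disc and their radius of convergence\<close>

lemma power_series_sums:
  fixes z :: "'a :: {real_normed_div_algebra, banach}"
  assumes "ereal (norm z) < conv_radius a"
  shows "(\<lambda>n. a n *\<^sub>R z ^ n) sums power_series a z"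
proof -
  have "summable (\<lambda>n. norm (a n * norm z ^ n))"
    using assms by (intro abs_summable_in_conv_radius) simp
  then have "summable (\<lambda>n. norm (a n *\<^sub>R z ^ n))"
    by (simp add: norm_power abs_mult)
  then show ?thesis
    unfolding power_series_def by (rule summable_sums[OF summable_norm_cancel])
qed

lemma power_series_of_real:
  assumes "ereal \<bar>t\<bar> < conv_radius a"
  shows "power_series a (complex_of_real t) = of_real (power_series a t)"
proof -
  have "(\<lambda>n. complex_of_real (a n *\<^sub>R t ^ n)) sums of_real (power_series a t)"
    by (intro sums_of_real power_series_sums) (use assms in simp)
  moreover have "(\<lambda>n. a n *\<^sub>R complex_of_real t ^ n) sums power_series a (complex_of_real t)"
    by (intro power_series_sums) (use assms in simp)
  ultimately show ?thesis
    by (simp add: scaleR_conv_of_real sums_iff)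
qed

lemma conv_radius_of_real: "conv_radius (\<lambda>n. complex_of_real (a n)) = conv_radius a"
  by (subst (1 2) conv_radius_norm[symmetric]) simp

text \<open>Comparison test inside the disc of \<open>a\<close>. Index 0 is exempt because the bound
  \<open>exp (b 0) * b n \<le> a n\<close>, to which the comparison is applied later, fails there
  when \<open>b 0 > 1\<close>.\<close>

lemma conv_radius_antimono_real:
  fixes a b :: "nat \<Rightarrow> real"
  assumes "\<And>n. n \<ge> 1 \<Longrightarrow> \<bar>b n\<bar> \<le> a n"
  shows "conv_radius a \<le> conv_radius b"
proof (rule conv_radius_geI_ex)
  fix r :: real assume r: "0 < r" "ereal r < conv_radius a"
  have "summable (\<lambda>n. a n * r ^ n)"
    using r by (intro khinchin_series_summable) simp
  then have "summable (\<lambda>n. b n * r ^ n)"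
    by (rule summable_comparison_test_ev[rotated])
       (use r assms in \<open>auto intro!: eventually_sequentiallyI[of 1] mult_right_mono simp: abs_mult\<close>)
  then show "\<exists>z. norm z = r \<and> summable (\<lambda>n. b n * z ^ n)"
    using r by (intro exI[of _ r]) auto
qed

section \<open>Taylor coefficients of the exponential of a power series\<close>

text \<open>The recursion \<open>(n + 1) a\<^sub>n\<^sub>+\<^sub>1 = \<Sum>\<^sub>i (i + 1) b\<^sub>i\<^sub>+\<^sub>1 a\<^sub>n\<^sub>-\<^sub>i\<close>, read off from \<open>f' = g' f\<close>,
  gives both the positivity of the \<open>a\<^sub>n\<close> and the bound \<open>a\<^sub>n \<ge> e\<^bsup>b\<^sub>0\<^esup> b\<^sub>n\<close>;
  the latter prevents the radius of convergence from growing.\<close>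

lemma exp_power_series_coeffs:
  fixes b :: "nat \<Rightarrow> real"
  assumes b: "\<And>n. b n \<ge> 0" and R: "conv_radius b > 0"
  obtains a where "a 0 > 0" "\<And>n. a n \<ge> 0" "\<And>n. n \<ge> 1 \<Longrightarrow> exp (b 0) * b n \<le> a n"
    "conv_radius a = conv_radius b"
    "\<And>z::complex. ereal (cmod z) < conv_radius b \<Longrightarrow> exp (power_series b z) = power_series a z"
proof -
  define G where "G = Abs_fps (\<lambda>n. complex_of_real (b n))"
  define f where "f = (\<lambda>z. exp (eval_fps G z))"
  define F where "F = fps_expansion f 0"
  \<comment> \<open>Real parts are taken before the coefficients of \<open>F\<close> are known to be
    real; \<open>real_nonneg\<close> shows that nothing is lost.\<close>
  define a where "a = (\<lambda>n. Re (fps_nth F n))"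
  have RG: "fps_conv_radius G = conv_radius b"
    by (simp add: fps_conv_radius_def G_def conv_radius_of_real)
  have evG: "eval_fps G z = power_series b z" for z
    by (simp add: eval_fps_def power_series_def G_def scaleR_conv_of_real)
  have holo: "f holomorphic_on eball 0 (conv_radius b)"
    unfolding f_def by (intro holomorphic_intros) (simp add: RG)
  have RF: "fps_conv_radius F \<ge> conv_radius b"
    unfolding F_def by (intro conv_radius_fps_expansion holo)
  have evF: "eval_fps F z = f z" if "ereal (cmod z) < conv_radius b" for z
    unfolding F_def using eval_fps_expansion'[OF holo that] by simp
  have ev: "eventually (\<lambda>z. z \<in> eball 0 (conv_radius b)) (nhds (0::complex))"
    using R by (intro eventually_nhds_in_open) (auto simp: zero_ereal_def)
  have fF: "f has_fps_expansion F"
    unfolding has_fps_expansion_def using ev R RF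
    by (auto elim!: eventually_mono simp: evF in_eball_iff)
  have gG: "eval_fps G has_fps_expansion G"
    by (intro eval_fps_has_fps_expansion) (simp add: RG R)
  \<comment> \<open>The equation f' = g' f is first shown pointwise near 0; uniqueness of Taylor
    expansions then turns it into the formal identity \<open>ode\<close>.\<close>
  have "eventually (\<lambda>z. deriv f z = deriv (eval_fps G) z * f z) (nhds 0)"
    using ev
  proof eventually_elim
    case (elim z)
    then have "(eval_fps G has_field_derivative deriv (eval_fps G) z) (at z)"
      by (intro holomorphic_derivI[of _ "eball 0 (conv_radius b)"] holomorphic_intros)
         (auto simp: RG)
    then have "(f has_field_derivative deriv (eval_fps G) z * f z) (at z)"
      unfolding f_def by (auto dest: DERIV_fun_exp simp: mult.commute)
    then show ?case by (rule DERIV_imp_deriv)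
  qed
  then have "deriv f has_fps_expansion F' \<longleftrightarrow>
      (\<lambda>z. deriv (eval_fps G) z * f z) has_fps_expansion F'" for F'
    by (intro has_fps_expansion_cong) auto
  then have "deriv f has_fps_expansion fps_deriv G * F"
    using has_fps_expansion_mult[OF has_fps_expansion_deriv[OF gG] fF] by simp
  then have ode: "fps_deriv F = fps_deriv G * F"
    using has_fps_expansion_deriv[OF fF] fps_expansion_unique_complex by blast
  have rec: "of_nat (Suc n) * fps_nth F (Suc n) =
      (\<Sum>i=0..n. of_nat (Suc i) * of_real (b (Suc i)) * fps_nth F (n - i))" for n
    using arg_cong[OF ode, of "\<lambda>H. fps_nth H n"] by (simp add: fps_mult_nth G_def)
  have "fps_nth F 0 = f 0"
    using evF[of 0] R by (simp add: zero_ereal_def eval_fps_at_0)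
  also have "f 0 = of_real (exp (b 0))"
    by (simp add: f_def eval_fps_at_0 G_def exp_of_real)
  finally have F0: "fps_nth F 0 = of_real (exp (b 0))" .
  have real_nonneg: "fps_nth F n = of_real (a n) \<and> a n \<ge> 0" for n
  proof (induction n rule: less_induct)
    case (less n)
    show ?case
    proof (cases n)
      case 0
      then show ?thesis by (simp add: a_def F0)
    next
      case (Suc m)
      define s where "s = (\<Sum>i=0..m. real (Suc i) * b (Suc i) * a (m - i))"
      have "of_nat (Suc m) * fps_nth F (Suc m) = complex_of_real s"
        unfolding rec s_def of_real_sum by (intro sum.cong) (use less Suc in auto)
      then have "fps_nth F n = complex_of_real (s / real (Suc m))"
        unfolding Suc by (subst of_real_divide, subst nonzero_eq_divide_eq)
          (simp_all del: of_nat_Suc add: mult.commute)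
      moreover have "s \<ge> 0"
        unfolding s_def by (intro sum_nonneg) (use less Suc b in auto)
      ultimately show ?thesis by (simp add: a_def)
    qed
  qed
  have rec': "real (Suc n) * a (Suc n) = (\<Sum>i=0..n. real (Suc i) * b (Suc i) * a (n - i))" for n
  proof -
    have "complex_of_real (real (Suc n) * a (Suc n)) =
        of_real (\<Sum>i=0..n. real (Suc i) * b (Suc i) * a (n - i))"
      using rec[of n] real_nonneg by simp
    then show ?thesis by (simp only: of_real_eq_iff)
  qed
  have a0: "a 0 = exp (b 0)" by (simp add: a_def F0)
  have lower: "exp (b 0) * b n \<le> a n" if n: "n \<ge> 1" for n
  proof -
    obtain m where m: "n = Suc m" using n by (cases n) auto
    \<comment> \<open>All terms of the recursion are nonnegative, and only \<open>i = m\<close> is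
      kept. The index \<open>m - m\<close> is left unreduced to match that summand; the last factor
      is \<open>a 0 = exp (b 0)\<close>.\<close>
    have "real (Suc m) * b (Suc m) * a (m - m) \<le> real (Suc m) * a (Suc m)"
      unfolding rec' by (rule member_le_sum) (use b real_nonneg in auto)
    then show ?thesis by (simp add: m a0 mult.commute)
  qed
  have "F = Abs_fps (\<lambda>n. complex_of_real (a n))"
    using real_nonneg by (simp add: fps_eq_iff)
  then have RFa: "fps_conv_radius F = conv_radius a"
    and evFa: "eval_fps F z = power_series a z" for z
    by (simp_all add: fps_conv_radius_def conv_radius_of_real eval_fps_def power_series_def
        scaleR_conv_of_real)
  have "conv_radius a \<le> conv_radius (\<lambda>n. exp (b 0) * b n)"
    by (rule conv_radius_antimono_real) (use lower b in auto)
  then have "conv_radius a \<le> conv_radius b"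
    by (simp add: conv_radius_cmult_left)
  with RF RFa have "conv_radius a = conv_radius b" by simp
  then show thesis
    using that[of a] a0 real_nonneg lower evF evFa by (simp add: f_def evG)
qed

section \<open>Expectations as sums of series\<close>

lemma expectation_nat_pmf:
  fixes f :: "nat \<Rightarrow> 'b :: {banach, second_countable_topology}"
  assumes "summable (\<lambda>n. norm (pmf p n *\<^sub>R f n))"
  shows "integrable (measure_pmf p) f"
    and "measure_pmf.expectation p f = (\<Sum>n. pmf p n *\<^sub>R f n)"
proof -
  have i: "integrable (count_space UNIV) (\<lambda>n. pmf p n *\<^sub>R f n)"
    using assms by (simp add: integrable_count_space_nat_iff)
  then show "integrable (measure_pmf p) f"
    by (simp add: measure_pmf_eq_density integrable_density)
  show "measure_pmf.expectation p f = (\<Sum>n. pmf p n *\<^sub>R f n)"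
    using integral_count_space_nat[OF i] by (simp add: measure_pmf_eq_density integral_density)
qed


text \<open>\<open>S\<close> is the sum before normalization, so that moments and the characteristic
  function can be read off from derivatives or values of the series and divided by f(t) at the end.
  Integrability is recorded as well because the variance formula asks for it.\<close>

lemma khinchin_expectation:
  fixes \<phi> :: "nat \<Rightarrow> 'b :: {banach, second_countable_topology}"
  assumes a: "khinchin_series a" and t: "0 \<le> t" "ereal t < conv_radius a"
    and summ: "summable (\<lambda>n. norm ((a n * t ^ n) *\<^sub>R \<phi> n))"
    and S: "(\<lambda>n. (a n * t ^ n) *\<^sub>R \<phi> n) sums S"
  shows "integrable (measure_pmf (khinchin a t)) \<phi>"
    and "measure_pmf.expectation (khinchin a t) \<phi> = S /\<^sub>R power_series a t"
proof -
  have eq: "pmf (khinchin a t) n *\<^sub>R \<phi> n = ((a n * t ^ n) *\<^sub>R \<phi> n) /\<^sub>R power_series a t" for n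
    using pmf_khinchin[OF a t] by (simp add: field_simps)
  have summ': "summable (\<lambda>n. norm (pmf (khinchin a t) n *\<^sub>R \<phi> n))"
    unfolding eq norm_scaleR[of "inverse (power_series a t)"] using summ by (rule summable_mult)
  show "integrable (measure_pmf (khinchin a t)) \<phi>"
    using summ' by (rule expectation_nat_pmf)
  have "(\<lambda>n. pmf (khinchin a t) n *\<^sub>R \<phi> n) sums (S /\<^sub>R power_series a t)"
    unfolding eq using S by (rule sums_scaleR_right)
  then show "measure_pmf.expectation (khinchin a t) \<phi> = S /\<^sub>R power_series a t"
    using expectation_nat_pmf(2)[OF summ'] by (simp add: sums_iff)
qed

section \<open>Higher derivatives and the series of \<open>omega\<close>\<close>

lemma eventually_conv_radius:
  fixes t :: real
  assumes "ereal \<bar>t\<bar> < R"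
  shows "eventually (\<lambda>x. ereal \<bar>x\<bar> < R) (nhds t)"
proof -
  have "eventually (\<lambda>x. x \<in> eball 0 R) (nhds t)"
    using assms by (intro eventually_nhds_in_open) auto
  then show ?thesis by simp
qed

lemma higher_deriv_power_series:
  fixes t :: real
  assumes "ereal \<bar>t\<bar> < conv_radius b"
  shows "ereal \<bar>t\<bar> < conv_radius ((diffs ^^ k) b)"
    and "(deriv ^^ k) (power_series b) t = power_series ((diffs ^^ k) b) t"
proof -
  have *: "ereal \<bar>x\<bar> < conv_radius ((diffs ^^ k) b)" if "ereal \<bar>x\<bar> < conv_radius b" for x k
    by (induction k) (use that power_series_DERIV(2) in auto)
  then show "ereal \<bar>t\<bar> < conv_radius ((diffs ^^ k) b)" using assms by simp
  show "(deriv ^^ k) (power_series b) t = power_series ((diffs ^^ k) b) t"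
    using assms
  \<comment> \<open>The point is generalized because the next derivative at \<open>t\<close> depends
    on the previous one in a whole neighbourhood of \<open>t\<close>.\<close>
  proof (induction k arbitrary: t)
    case (Suc k)
    have "eventually (\<lambda>x. (deriv ^^ k) (power_series b) x = power_series ((diffs ^^ k) b) x) (nhds t)"
      using eventually_conv_radius[OF Suc.prems] by eventually_elim (rule Suc.IH)
    then have "deriv ((deriv ^^ k) (power_series b)) t = deriv (power_series ((diffs ^^ k) b)) t"
      by (rule deriv_cong_ev) simp
    also have "\<dots> = power_series (diffs ((diffs ^^ k) b)) t"
      by (intro DERIV_imp_deriv power_series_DERIV * Suc.prems)
    finally show ?case by simp
  qed simp
qed

lemma power_series_diffs_sums:
  fixes t :: real
  assumes "ereal \<bar>t\<bar> < conv_radius b"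
  shows "(\<lambda>n. real n * b n * t ^ n) sums (t * power_series (diffs b) t)"
proof -
  have "(\<lambda>n. diffs b n *\<^sub>R t ^ n) sums power_series (diffs b) t"
    by (intro power_series_sums) (use power_series_DERIV(2)[OF assms] in simp)
  then have "(\<lambda>n. t * (diffs b n *\<^sub>R t ^ n)) sums (t * power_series (diffs b) t)"
    by (rule sums_mult)
  then have "(\<lambda>n. real (Suc n) * b (Suc n) * t ^ Suc n) sums (t * power_series (diffs b) t)"
    by (simp add: diffs_def mult_ac)
  then show ?thesis
    by (subst (asm) sums_Suc_iff) simp
qed

text \<open>The factor of \<open>b n * t ^ n\<close> in \<open>6 * omega b t\<close>. The falling
  factorial comes from t^3 g'''(t); the entries 1 = 1^3 and 8 = 2^3 serve the positive indices at
  which it vanishes, so that the weights can dominate n^3 for every n.\<close>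

definition omega_coeff :: "nat \<Rightarrow> real" where
  "omega_coeff n = (if n = 1 then 1 else 0) + (if n = 2 then 8 else 0)
     + 9 / 2 * (real n * (real n - 1) * (real n - 2))"

lemma omega_sums:
  assumes t: "ereal \<bar>t\<bar> < conv_radius b"
  shows "(\<lambda>n. 1 / 6 * omega_coeff n * b n * t ^ n) sums omega b t"
proof -
  \<comment> \<open>The first-order formula applied to \<open>diffs (diffs b)\<close> and multiplied
    by t^2 gives the third-derivative series with its index shifted by two.\<close>
  have "(\<lambda>n. real n * diffs (diffs b) n * t ^ n) sums (t * power_series (diffs (diffs (diffs b))) t)"
    by (intro power_series_diffs_sums power_series_DERIV(2) t)
  then have "(\<lambda>n. t\<^sup>2 * (real n * diffs (diffs b) n * t ^ n))
      sums (t\<^sup>2 * (t * power_series (diffs (diffs (diffs b))) t))"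
    by (rule sums_mult)
  also have "t\<^sup>2 * (t * power_series (diffs (diffs (diffs b))) t) = t ^ 3 * (deriv ^^ 3) (power_series b) t"
    using higher_deriv_power_series(2)[OF t, of 3]
    by (simp add: numeral_3_eq_3 power2_eq_square)
  also have "(\<lambda>n. t\<^sup>2 * (real n * diffs (diffs b) n * t ^ n)) = (\<lambda>n. real (Suc (Suc n)) *
      (real (Suc (Suc n)) - 1) * (real (Suc (Suc n)) - 2) * b (Suc (Suc n)) * t ^ Suc (Suc n))"
    by (simp add: diffs_def power2_eq_square mult_ac add_ac)
  \<comment> \<open>Undoing the shift adds no terms: the falling factorial is 0 at the restored
    indices 1 and 0.\<close>
  finally have "(\<lambda>n. real (Suc n) * (real (Suc n) - 1) * (real (Suc n) - 2) * b (Suc n) * t ^ Suc n)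
      sums (t ^ 3 * (deriv ^^ 3) (power_series b) t)"
    by (subst (asm) sums_Suc_iff) simp
  then have d3: "(\<lambda>n. real n * (real n - 1) * (real n - 2) * b n * t ^ n)
      sums (t ^ 3 * (deriv ^^ 3) (power_series b) t)"
    by (subst (asm) sums_Suc_iff) simp
  have "(\<lambda>n. 1 / 6 * ((if n = 1 then b n * t ^ n else 0) + 8 * (if n = 2 then b n * t ^ n else 0)
            + 9 / 2 * (real n * (real n - 1) * (real n - 2) * b n * t ^ n)))
      sums (1 / 6 * (b 1 * t ^ 1 + 8 * (b 2 * t ^ 2) + 9 / 2 * (t ^ 3 * (deriv ^^ 3) (power_series b) t)))"
    by (intro sums_mult sums_add d3 sums_single)
  moreover have "1 / 6 * ((if n = 1 then b n * t ^ n else 0) + 8 * (if n = 2 then b n * t ^ n else 0)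
            + 9 / 2 * (real n * (real n - 1) * (real n - 2) * b n * t ^ n)) =
      1 / 6 * omega_coeff n * b n * t ^ n" for n
    by (auto simp: omega_coeff_def algebra_simps)
  ultimately show ?thesis
    by (simp only: omega_def mult.assoc power_one_right)
qed

text \<open>For \<open>n \<ge> 3\<close> this amounts to \<open>n (n - 3) (7 n - 6) \<ge> 0\<close>, so the constant \<open>9/2\<close> is sharp at \<open>n = 3\<close>.\<close>

lemma cube_le_omega_coeff: "real n ^ 3 \<le> omega_coeff n"
proof -
  consider "n = 0" | "n = 1" | "n = 2" | "n \<ge> 3" by linarith
  then show ?thesis
  proof cases
    case 4
    then have "0 \<le> real n * ((real n - 3) * (7 * real n - 6))"
      by (intro mult_nonneg_nonneg) auto
    with 4 show ?thesis
      by (simp add: omega_coeff_def algebra_simps power3_eq_cube)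
  qed (auto simp: omega_coeff_def)
qed

text \<open>The weights dominate cubes, hence are nonnegative. The sign makes the remainder bound
  monotone in \<bar>\<phi>\<bar>, so that it can be evaluated at \<open>h t\<close>.\<close>

lemma omega_nonneg:
  assumes b: "\<And>n. b n \<ge> 0" and t: "0 \<le> t" "ereal t < conv_radius b"
  shows "0 \<le> omega b t"
proof (rule sums_le[OF _ sums_zero omega_sums])
  fix n
  have "0 \<le> omega_coeff n"
    by (rule order_trans[OF _ cube_le_omega_coeff]) simp
  then show "0 \<le> 1 / 6 * omega_coeff n * b n * t ^ n"
    using b[of n] t by (intro mult_nonneg_nonneg) auto
qed (use t in simp)

section \<open>Second-order expansion of the exponent\<close>

text \<open>The n-th term is \<open>b n * t ^ n\<close> times the second-order Taylor remainder of
  e^(i n \<phi>), whose cubic bound holds for all real \<phi>; the factor 1/6 in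
  \<open>omega\<close> is the 1/3! of that bound.\<close>

lemma cumulant_remainder_bound:
  assumes b: "\<And>n. b n \<ge> 0" and t: "0 \<le> t" "ereal t < conv_radius b"
  shows "cmod (power_series b (of_real t * iexp \<phi>) - of_real (power_series b t)
           - \<i> * of_real (\<phi> * (t * deriv (power_series b) t)) + of_real (\<phi>\<^sup>2 / 2 * sigma_sq b t))
         \<le> omega b t * \<bar>\<phi>\<bar> ^ 3" (is "cmod ?L \<le> _")
proof -
  have t': "ereal \<bar>t\<bar> < conv_radius b" using t by simp
  have norm: "ereal (norm (of_real t * iexp \<phi>)) < conv_radius b"
    using t by (simp add: norm_mult)
  have m: "(\<lambda>n. real n * b n * t ^ n) sums (t * deriv (power_series b) t)"
    using power_series_diffs_sums[OF t'] higher_deriv_power_series(2)[OF t', of 1] by simp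
  have g: "(\<lambda>n. b n *\<^sub>R t ^ n) sums power_series b t"
    by (intro power_series_sums) (use t' in simp)
  define r where "r = (\<lambda>n. (b n * t ^ n) *\<^sub>R
      (iexp (real n * \<phi>) - 1 - \<i> * of_real (real n * \<phi>) + of_real ((real n * \<phi>)\<^sup>2 / 2)))"
  have "(\<lambda>n. b n *\<^sub>R (of_real t * iexp \<phi>) ^ n - of_real (b n *\<^sub>R t ^ n)
           - \<i> * of_real (\<phi> * (real n * b n * t ^ n)) + of_real (\<phi>\<^sup>2 / 2 * ((real n)\<^sup>2 * b n * t ^ n))) sums ?L"
    by (intro sums_add sums_diff sums_mult sums_of_real power_series_sums[OF norm] g m
        sigma_sq_sums t')
  moreover have "b n *\<^sub>R (of_real t * iexp \<phi>) ^ n - of_real (b n *\<^sub>R t ^ n)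
           - \<i> * of_real (\<phi> * (real n * b n * t ^ n)) + of_real (\<phi>\<^sup>2 / 2 * ((real n)\<^sup>2 * b n * t ^ n)) = r n" for n
  proof -
    have "iexp \<phi> ^ n = iexp (real n * \<phi>)"
      by (subst exp_of_nat_mult[symmetric]) (simp add: mult_ac)
    then show ?thesis
      by (simp add: r_def power_mult_distrib scaleR_conv_of_real algebra_simps)
  qed
  ultimately have r: "r sums ?L" by simp
  have bound: "cmod (r n) \<le> (1 / 6 * omega_coeff n * b n * t ^ n) * \<bar>\<phi>\<bar> ^ 3" for n
  proof -
    have taylor: "iexp (real n * \<phi>) - (\<Sum>k\<le>2. (\<i> * complex_of_real (real n * \<phi>)) ^ k / fact k) =
        iexp (real n * \<phi>) - 1 - \<i> * of_real (real n * \<phi>) + of_real ((real n * \<phi>)\<^sup>2 / 2)"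
      by (simp add: numeral_2_eq_2 power_mult_distrib)
    have "cmod (iexp (real n * \<phi>) - 1 - \<i> * of_real (real n * \<phi>) + of_real ((real n * \<phi>)\<^sup>2 / 2))
        \<le> \<bar>real n * \<phi>\<bar> ^ Suc 2 / fact (Suc 2)"
      using iexp_approx1[of "real n * \<phi>" 2] unfolding taylor .
    also have "\<dots> = 1 / 6 * real n ^ 3 * \<bar>\<phi>\<bar> ^ 3"
      by (simp add: fact_numeral abs_mult power_mult_distrib eval_nat_numeral)
    also have "\<dots> \<le> 1 / 6 * omega_coeff n * \<bar>\<phi>\<bar> ^ 3"
      by (intro mult_right_mono mult_left_mono cube_le_omega_coeff) auto
    finally have "b n * t ^ n * cmod (iexp (real n * \<phi>) - 1 - \<i> * of_real (real n * \<phi>) + of_real ((real n * \<phi>)\<^sup>2 / 2))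
       \<le> b n * t ^ n * (1 / 6 * omega_coeff n * \<bar>\<phi>\<bar> ^ 3)"
      by (rule mult_left_mono) (use b t in auto)
    also have "\<dots> = (1 / 6 * omega_coeff n * b n * t ^ n) * \<bar>\<phi>\<bar> ^ 3"
      by (simp only: mult_ac)
    finally show ?thesis
      using mult_nonneg_nonneg[OF b zero_le_power[OF t(1)], of n n] by (simp only: r_def norm_scaleR abs_of_nonneg)
  qed
  note s = sums_mult2[OF omega_sums[OF t'], of "\<bar>\<phi>\<bar> ^ 3"]
  have "cmod (suminf r) \<le> (\<Sum>n. (1 / 6 * omega_coeff n * b n * t ^ n) * \<bar>\<phi>\<bar> ^ 3)"
    using bound sums_summable[OF s] by (rule norm_suminf_le)
  then show ?thesis
    using sums_unique[OF s] sums_unique[OF r] by simp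
qed

section \<open>Moments and characteristic function of the family of e^g\<close>

text \<open>From f' = g' f and f'' = (g'' + g'^2) f, the mean is t g' and the second moment is t g'
  + t^2 g'' + (t g')^2; subtracting the squared mean leaves \<open>sigma_sq b t\<close>. The
  equation f = e^g is assumed on a whole real interval because it gets differentiated twice.\<close>

lemma khinchin_mean_sd_exp:
  assumes a: "khinchin_series a" and R: "conv_radius a = conv_radius b"
    and exp: "\<And>x::real. ereal \<bar>x\<bar> < conv_radius b \<Longrightarrow> power_series a x = exp (power_series b x)"
    and t: "0 \<le> t" "ereal t < conv_radius b"
  shows "khinchin_mean a t = t * deriv (power_series b) t"
    and "khinchin_sd a t = sqrt (sigma_sq b t)"
proof -
  have tb: "ereal \<bar>t\<bar> < conv_radius b" and ta: "ereal \<bar>t\<bar> < conv_radius a" "ereal t < conv_radius a"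
    using t R by auto
  define g' :: "real \<Rightarrow> real" where "g' = deriv (power_series b)"
  have g': "(power_series b has_real_derivative g' x) (at x)" if "ereal \<bar>x\<bar> < conv_radius b" for x
    using power_series_DERIV(1)[OF that] by (simp add: g'_def DERIV_imp_deriv)
  have g'': "(g' has_real_derivative deriv g' t) (at t)"
  proof -
    have "(power_series (diffs b) has_real_derivative power_series (diffs (diffs b)) t) (at t)"
      by (intro power_series_DERIV tb)
    moreover have "eventually (\<lambda>x. g' x = power_series (diffs b) x) (nhds t)"
      using eventually_conv_radius[OF tb]
      by eventually_elim (simp add: g'_def DERIV_imp_deriv power_series_DERIV(1))
    ultimately have "(g' has_real_derivative power_series (diffs (diffs b)) t) (at t)"
      using DERIV_cong_ev[of t t g' "power_series (diffs b)"] by blast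
    then show ?thesis by (simp add: DERIV_imp_deriv)
  qed
  have f': "deriv (power_series a) x = g' x * exp (power_series b x)"
    if "ereal \<bar>x\<bar> < conv_radius b" for x
  proof -
    have "eventually (\<lambda>x. power_series a x = exp (power_series b x)) (nhds x)"
      using eventually_conv_radius[OF that] by eventually_elim (rule exp)
    then have "deriv (power_series a) x = deriv (\<lambda>x. exp (power_series b x)) x"
      by (rule deriv_cong_ev) simp
    also have "\<dots> = g' x * exp (power_series b x)"
      using DERIV_fun_exp[OF g'[OF that]] by (simp add: DERIV_imp_deriv mult.commute)
    finally show ?thesis .
  qed
  have f'': "(deriv ^^ 2) (power_series a) t = (deriv g' t + (g' t)\<^sup>2) * exp (power_series b t)"
  proof -
    have "eventually (\<lambda>x. deriv (power_series a) x = g' x * exp (power_series b x)) (nhds t)"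
      using eventually_conv_radius[OF tb] by eventually_elim (rule f')
    then have "deriv (deriv (power_series a)) t = deriv (\<lambda>x. g' x * exp (power_series b x)) t"
      by (rule deriv_cong_ev) simp
    also have "((\<lambda>x. g' x * exp (power_series b x)) has_real_derivative
        (deriv g' t + (g' t)\<^sup>2) * exp (power_series b t)) (at t)"
      using DERIV_mult[OF g'' DERIV_fun_exp[OF g'[OF tb]]]
      by (simp add: algebra_simps power2_eq_square)
    then have "deriv (\<lambda>x. g' x * exp (power_series b x)) t =
        (deriv g' t + (g' t)\<^sup>2) * exp (power_series b t)"
      by (rule DERIV_imp_deriv)
    finally show ?thesis by (simp add: numeral_2_eq_2)
  qed
  have nn: "a n * t ^ n \<ge> 0" for n
    using a t by (simp add: khinchin_series_def)
  have s1: "(\<lambda>n. (a n * t ^ n) *\<^sub>R real n) sums (t * deriv (power_series a) t)"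
    using power_series_diffs_sums[OF ta(1)] higher_deriv_power_series(2)[OF ta(1), of 1]
    by (simp add: mult_ac)
  have s2: "(\<lambda>n. (a n * t ^ n) *\<^sub>R (real n)\<^sup>2) sums sigma_sq a t"
    using sigma_sq_sums[OF ta(1)] by (simp add: mult_ac)
  have n1: "summable (\<lambda>n. norm ((a n * t ^ n) *\<^sub>R real n))"
    using sums_summable[OF s1] nn by (simp add: abs_mult[of "_ * _"])
  have n2: "summable (\<lambda>n. norm ((a n * t ^ n) *\<^sub>R (real n)\<^sup>2))"
    using sums_summable[OF s2] nn by (simp add: abs_mult[of "_ * _"])
  note E1 = khinchin_expectation[OF a t(1) ta(2) n1 s1]
  note E2 = khinchin_expectation[OF a t(1) ta(2) n2 s2]
  show mean: "khinchin_mean a t = t * deriv (power_series b) t"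
    using E1(2) by (simp add: khinchin_mean_def f'[OF tb] exp[OF tb] g'_def field_simps)
  have "measure_pmf.variance (khinchin a t) real =
      sigma_sq a t /\<^sub>R power_series a t - (t * deriv (power_series b) t)\<^sup>2"
    using measure_pmf.variance_eq[OF E1(1) E2(1)] E2(2) mean
    by (simp add: khinchin_mean_def)
  also have "\<dots> = sigma_sq b t"
  proof -
    have "(deriv ^^ 2) (power_series b) t = deriv g' t"
      by (simp add: numeral_2_eq_2 g'_def)
    then show ?thesis
      unfolding sigma_sq_def f'' f'[OF tb] exp[OF tb] g'_def[symmetric]
      by (simp add: field_simps power2_eq_square)
  qed
  finally show "khinchin_sd a t = sqrt (sigma_sq b t)"
    by (simp add: khinchin_sd_def)
qed

text \<open>Before centering, the expectation of e^(i \<phi> X) is f(t e^(i \<phi>)) / f(t);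
  subtracting the mean contributes the leading exponential.\<close>

lemma khinchin_char_eq:
  assumes a: "khinchin_series a" and t: "0 \<le> t" "ereal t < conv_radius a"
  shows "khinchin_char a t \<theta> =
    exp (- \<i> * of_real (\<theta> / khinchin_sd a t * khinchin_mean a t)) *
      power_series a (of_real t * iexp (\<theta> / khinchin_sd a t)) / of_real (power_series a t)"
proof -
  define m \<sigma> \<phi> where "m = khinchin_mean a t" and "\<sigma> = khinchin_sd a t" and "\<phi> = \<theta> / \<sigma>"
  have nn: "a n * t ^ n \<ge> 0" for n
    using a t by (simp add: khinchin_series_def)
  have summ: "summable (\<lambda>n. norm ((a n * t ^ n) *\<^sub>R iexp (\<theta> * ((real n - m) / \<sigma>))))"
    using khinchin_series_summable[of t a] nn t by simp
  have "(\<lambda>n. exp (- \<i> * of_real (\<phi> * m)) * (a n *\<^sub>R (of_real t * iexp \<phi>) ^ n)) sums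
      (exp (- \<i> * of_real (\<phi> * m)) * power_series a (of_real t * iexp \<phi>))"
    by (intro sums_mult power_series_sums) (use t in \<open>simp add: norm_mult\<close>)
  moreover have "exp (- \<i> * of_real (\<phi> * m)) * (a n *\<^sub>R (of_real t * iexp \<phi>) ^ n) =
      (a n * t ^ n) *\<^sub>R iexp (\<theta> * ((real n - m) / \<sigma>))" for n
  proof -
    have "iexp \<phi> ^ n = iexp (real n * \<phi>)"
      by (subst exp_of_nat_mult[symmetric]) (simp add: mult_ac)
    moreover have "exp (- \<i> * of_real (\<phi> * m)) * iexp (real n * \<phi>) = iexp (\<theta> * ((real n - m) / \<sigma>))"
    proof -
      \<comment> \<open>This also covers a zero standard deviation, where \<open>x / 0 = 0\<close>
        makes both sides vanish.\<close>
      have "\<theta> * ((real n - m) / \<sigma>) = real n * \<phi> - \<phi> * m"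
        by (simp add: \<phi>_def right_diff_distrib diff_divide_distrib)
      then show ?thesis
        by (simp only: of_real_diff right_diff_distrib exp_diff exp_minus divide_inverse mult_minus_left
            mult.commute)
    qed
    ultimately show ?thesis
      by (simp add: power_mult_distrib scaleR_conv_of_real mult_ac)
  qed
  ultimately have "(\<lambda>n. (a n * t ^ n) *\<^sub>R iexp (\<theta> * ((real n - m) / \<sigma>))) sums
      (exp (- \<i> * of_real (\<phi> * m)) * power_series a (of_real t * iexp \<phi>))"
    by simp
  from khinchin_expectation(2)[OF a t summ this] show ?thesis
    by (simp add: khinchin_char_def m_def \<sigma>_def \<phi>_def scaleR_conv_of_real divide_inverse mult_ac)
qed

text \<open>Triangle inequality with nonnegative coefficients. It supplies the upper bound behind
  the supremum in condition (iii): a real \<open>SUP\<close> is known to dominate its members only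
  when the family is bounded above.\<close>

lemma Re_power_series_le:
  fixes z :: complex
  assumes b: "\<And>n. b n \<ge> 0" and z: "ereal (cmod z) < conv_radius b"
  shows "Re (power_series b z) \<le> power_series b (cmod z)"
proof -
  have "(\<lambda>n. Re (b n *\<^sub>R z ^ n)) sums Re (power_series b z)"
    by (intro sums_Re power_series_sums z)
  moreover have "(\<lambda>n. b n *\<^sub>R cmod z ^ n) sums power_series b (cmod z)"
    by (intro power_series_sums) (use z in simp)
  moreover have "Re (b n *\<^sub>R z ^ n) \<le> b n *\<^sub>R cmod z ^ n" for n
    using b complex_Re_le_cmod[of "z ^ n"] by (auto simp: norm_power intro!: mult_left_mono)
  ultimately show ?thesis by (rule sums_le[rotated])
qed

lemma eventually_at_upto:
  assumes "ereal c < R"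
  shows "eventually (\<lambda>t. c < t \<and> ereal t < R) (at_upto R)"
proof -
  have "eventually (\<lambda>x. ereal c < x \<and> x < R) (at_left R)"
    using assms by (intro eventually_at_leftI[of "ereal c"]) auto
  from eventually_filtercomapI[OF this, of ereal] show ?thesis
    by (simp add: at_upto_def)
qed

section \<open>Verification of the Hayman conditions for e^g\<close>

theorem theorem5p2:
  fixes b :: "nat \<Rightarrow> real" and R :: ereal and h U V :: "real \<Rightarrow> real" and t0 :: real
  assumes "\<And>n. b n \<ge> 0"
    and "\<exists>n\<ge>1. b n \<noteq> 0"
    and "conv_radius b = R" and "R > 0"
    and "\<And>t. 0 \<le> t \<Longrightarrow> ereal t < R \<Longrightarrow> 0 < h t \<and> h t < pi"
    and "filterlim (\<lambda>t. t * deriv (power_series b) t + t\<^sup>2 * (deriv ^^ 2) (power_series b) t)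
           at_top (at_upto R)"
    and "((\<lambda>t. omega b t * h t ^ 3) \<longlongrightarrow> 0) (at_upto R)"
    and "0 < t0" and "ereal t0 < R"
    and "\<And>t. t0 < t \<Longrightarrow> ereal t < R \<Longrightarrow> 0 < U t \<and> U t \<le> pi"
    and "\<And>t. t0 < t \<Longrightarrow> ereal t < R \<Longrightarrow> 0 < V t"
    and "\<And>t w. t0 < t \<Longrightarrow> ereal t < R \<Longrightarrow> 0 \<le> w \<Longrightarrow> w \<le> U t \<Longrightarrow>
           (SUP \<theta>\<in>{\<theta>::real. w \<le> \<bar>\<theta>\<bar> \<and> \<bar>\<theta>\<bar> \<le> pi}.
              Re (power_series b (of_real t * exp (\<i> * of_real \<theta>))) - power_series b t)
             \<le> - V t * w\<^sup>2"
    and "\<And>t. t0 < t \<Longrightarrow> ereal t < R \<Longrightarrow> h t \<le> U t"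
    and "((\<lambda>t. sqrt (sigma_sq b t) * exp (- V t * (h t)\<^sup>2)) \<longlongrightarrow> 0) (at_upto R)"
  shows "hayman_class (\<lambda>z. exp (power_series b z))"
proof -
  note b = assms(1) and R = assms(3,4) and h = assms(5) and sigma_top = assms(6)
    and omega_h = assms(7) and t0 = assms(8,9) and tail = assms(12) and hU = assms(13)
    and sigma_V = assms(14)
  obtain a where a0: "a 0 > 0" and a_nn: "\<And>n. a n \<ge> 0"
    and a_ge: "\<And>n. n \<ge> 1 \<Longrightarrow> exp (b 0) * b n \<le> a n" and Ra: "conv_radius a = R"
    and fz: "\<And>z::complex. ereal (cmod z) < R \<Longrightarrow> exp (power_series b z) = power_series a z"
    using exp_power_series_coeffs[of b, unfolded R(1), OF b R(2)] by blast
  obtain k where k: "k \<ge> 1" "b k \<noteq> 0" using assms(2) by blast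
  \<comment> \<open>The lower bound on the coefficients carries nonconstancy over from g to
    f.\<close>
  have "0 < exp (b 0) * b k" using b[of k] k by simp
  then have "a k \<noteq> 0" using a_ge[OF k(1)] by linarith
  then have a: "khinchin_series a"
    using a0 a_nn k R Ra by (auto simp: khinchin_series_def)
  have fx: "power_series a x = exp (power_series b x)" if "ereal \<bar>x\<bar> < R" for x :: real
  proof -
    have "complex_of_real (power_series a x) = complex_of_real (exp (power_series b x))"
      using fz[of "of_real x"] that R(1) Ra
      by (simp add: power_series_of_real exp_of_real)
    then show ?thesis by (simp only: of_real_eq_iff)
  qed
  define \<sigma> m where "\<sigma> = khinchin_sd a" and "m = khinchin_mean a"
  have m: "m t = t * deriv (power_series b) t" and \<sigma>: "\<sigma> t = sqrt (sigma_sq b t)"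
    if "0 \<le> t" "ereal t < R" for t
    using khinchin_mean_sd_exp[OF a _ _ that(1), of b] that R Ra fx by (auto simp: m_def \<sigma>_def)
  \<comment> \<open>With f = e^g the quotient of series collapses into one exponential, so both
    Hayman estimates become estimates of its exponent.\<close>
  have char: "khinchin_char a t \<theta> = exp (power_series b (of_real t * iexp (\<theta> / \<sigma> t))
        - of_real (power_series b t) - \<i> * of_real (\<theta> / \<sigma> t * m t))"
    if t: "0 \<le> t" "ereal t < R" for t \<theta>
  proof -
    have "power_series a (of_real t * iexp (\<theta> / \<sigma> t)) = exp (power_series b (of_real t * iexp (\<theta> / \<sigma> t)))"
      using t by (intro fz[symmetric]) (simp add: norm_mult)
    moreover have "complex_of_real (power_series a t) = exp (of_real (power_series b t))"
      using fx[of t] t by (simp add: exp_of_real)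
    ultimately show ?thesis
      using khinchin_char_eq[OF a t(1), of \<theta>] t Ra
      by (simp add: \<sigma>_def m_def exp_add exp_diff exp_minus field_simps)
  qed
  have ev: "eventually (\<lambda>t. t0 < t \<and> ereal t < R) (at_upto R)"
    by (intro eventually_at_upto t0)
  have sigma_sq_top: "filterlim (sigma_sq b) at_top (at_upto R)"
    using sigma_top by (simp add: sigma_sq_def[abs_def])
  have \<sigma>_top: "filterlim \<sigma> at_top (at_upto R)"
  proof -
    have "filterlim (\<lambda>t. sqrt (sigma_sq b t)) at_top (at_upto R)"
      by (rule filterlim_compose[OF sqrt_at_top sigma_sq_top])
    moreover have "eventually (\<lambda>t. sqrt (sigma_sq b t) = \<sigma> t) (at_upto R)"
      using ev by eventually_elim (use t0 \<sigma> in auto)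
    ultimately show ?thesis
      using filterlim_cong by fastforce
  qed
  \<comment> \<open>Positivity of \<sigma>(t) near R lets the substitution \<phi> = \<theta> /
    \<sigma>(t) turn ranges of \<theta> into ranges of \<phi>.\<close>
  have \<sigma>_pos: "eventually (\<lambda>t. 0 < \<sigma> t) (at_upto R)"
    using \<sigma>_top by (simp add: filterlim_at_top_dense)
  have major: "((\<lambda>t. SUP \<theta>\<in>{\<theta>. \<bar>\<theta>\<bar> \<le> h t * \<sigma> t}.
      cmod (khinchin_char a t \<theta> * of_real (exp (\<theta>\<^sup>2 / 2)) - 1)) \<longlongrightarrow> 0) (at_upto R)"
  proof (rule tendsto_sandwich[where f = "\<lambda>_. 0"])
    let ?x = "\<lambda>t. omega b t * h t ^ 3"
    have "((\<lambda>t. exp (?x t) * ?x t) \<longlongrightarrow> exp 0 * 0) (at_upto R)"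
      by (intro tendsto_intros omega_h)
    then show "((\<lambda>t. exp (?x t) * ?x t) \<longlongrightarrow> 0) (at_upto R)" by simp
    have bound: "cmod (khinchin_char a t \<theta> * of_real (exp (\<theta>\<^sup>2 / 2)) - 1) \<le> exp (?x t) * ?x t"
      if t: "t0 < t" "ereal t < R" "0 < \<sigma> t" and \<theta>: "\<bar>\<theta>\<bar> \<le> h t * \<sigma> t" for t \<theta>
    proof -
      have t': "0 \<le> t" using t t0 by simp
      define \<phi> where "\<phi> = \<theta> / \<sigma> t"
      have \<phi>: "\<bar>\<phi>\<bar> \<le> h t" using \<theta> t by (simp add: \<phi>_def field_simps)
      define w where "w = power_series b (of_real t * iexp \<phi>) - of_real (power_series b t)
           - \<i> * of_real (\<phi> * (t * deriv (power_series b) t)) + of_real (\<phi>\<^sup>2 / 2 * sigma_sq b t)"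
      have "0 < sigma_sq b t" using t \<sigma>[OF t'] by simp
      then have "\<phi>\<^sup>2 / 2 * sigma_sq b t = \<theta>\<^sup>2 / 2"
        using \<sigma>[OF t' t(2)] t by (simp add: \<phi>_def power_divide)
      then have "khinchin_char a t \<theta> * of_real (exp (\<theta>\<^sup>2 / 2)) = exp w"
        unfolding char[OF t' t(2)] exp_of_real[symmetric] exp_add[symmetric] w_def
        using m[OF t' t(2)] by (simp add: \<phi>_def)
      have w: "cmod w \<le> omega b t * \<bar>\<phi>\<bar> ^ 3"
        unfolding w_def by (rule cumulant_remainder_bound) (use b t t' R in auto)
      have "0 \<le> omega b t"
        by (rule omega_nonneg) (use b t t' R in auto)
      then have "omega b t * \<bar>\<phi>\<bar> ^ 3 \<le> ?x t"
        using \<phi> by (intro mult_left_mono power_mono) auto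
      with w have w: "cmod w \<le> ?x t" by simp
      \<comment> \<open>Taylor's formula of order 0 bounds |e^w - 1| by |w| e^|Re w|. Both factors
        are controlled through \<open>?x t\<close>, so the bound is uniform in \<theta> and tends to
        0.\<close>
      have "cmod (exp w - 1) \<le> exp \<bar>Re w\<bar> * cmod w"
        using Taylor_exp[of w 0] by simp
      also have "\<dots> \<le> exp (?x t) * ?x t"
        using w abs_Re_le_cmod[of w] by (intro mult_mono) auto
      finally show ?thesis
        using \<open>khinchin_char a t \<theta> * of_real (exp (\<theta>\<^sup>2 / 2)) = exp w\<close> by simp
    qed
    \<comment> \<open>The rules for real suprema ask for a nonempty index set and a bounded family:
      \<theta> = 0 witnesses the former, \<open>bound\<close> gives the latter.\<close>
    have ne: "0 \<in> {\<theta>. \<bar>\<theta>\<bar> \<le> h t * \<sigma> t}" if "t0 < t" "ereal t < R" "0 < \<sigma> t" for t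
      using h[of t] that t0 by simp
    show "eventually (\<lambda>t. (SUP \<theta>\<in>{\<theta>. \<bar>\<theta>\<bar> \<le> h t * \<sigma> t}.
        cmod (khinchin_char a t \<theta> * of_real (exp (\<theta>\<^sup>2 / 2)) - 1)) \<le> exp (?x t) * ?x t) (at_upto R)"
      using ev \<sigma>_pos by eventually_elim (rule cSUP_least; use ne bound in blast)
    show "eventually (\<lambda>t. 0 \<le> (SUP \<theta>\<in>{\<theta>. \<bar>\<theta>\<bar> \<le> h t * \<sigma> t}.
        cmod (khinchin_char a t \<theta> * of_real (exp (\<theta>\<^sup>2 / 2)) - 1))) (at_upto R)"
      using ev \<sigma>_pos
    proof eventually_elim
      case (elim t)
      show ?case
      proof (rule cSUP_upper2)
        show "bdd_above ((\<lambda>\<theta>. cmod (khinchin_char a t \<theta> * of_real (exp (\<theta>\<^sup>2 / 2)) - 1)) `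
            {\<theta>. \<bar>\<theta>\<bar> \<le> h t * \<sigma> t})"
          by (rule bdd_aboveI2) (use bound elim in blast)
        show "0 \<in> {\<theta>. \<bar>\<theta>\<bar> \<le> h t * \<sigma> t}"
          using ne elim by blast
      qed simp
    qed
  qed simp
  have minor: "((\<lambda>t. \<sigma> t * (SUP \<theta>\<in>{\<theta>. h t * \<sigma> t \<le> \<bar>\<theta>\<bar> \<and> \<bar>\<theta>\<bar> \<le> pi * \<sigma> t}.
      cmod (khinchin_char a t \<theta>))) \<longlongrightarrow> 0) (at_upto R)"
  proof (rule tendsto_sandwich[where f = "\<lambda>_. 0"])
    show "((\<lambda>t. sqrt (sigma_sq b t) * exp (- V t * (h t)\<^sup>2)) \<longlongrightarrow> 0) (at_upto R)"
      by (rule sigma_V)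
    have bound: "cmod (khinchin_char a t \<theta>) \<le> exp (- V t * (h t)\<^sup>2)"
      if t: "t0 < t" "ereal t < R" "0 < \<sigma> t"
        and \<theta>: "h t * \<sigma> t \<le> \<bar>\<theta>\<bar>" "\<bar>\<theta>\<bar> \<le> pi * \<sigma> t" for t \<theta>
    proof -
      have t': "0 \<le> t" using t t0 by simp
      define \<phi> where "\<phi> = \<theta> / \<sigma> t"
      have \<phi>: "h t \<le> \<bar>\<phi>\<bar>" "\<bar>\<phi>\<bar> \<le> pi" using \<theta> t by (simp_all add: \<phi>_def field_simps)
      have "Re (power_series b (of_real t * iexp \<phi>)) - power_series b t
          \<le> (SUP \<theta>\<in>{\<theta>. h t \<le> \<bar>\<theta>\<bar> \<and> \<bar>\<theta>\<bar> \<le> pi}.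
               Re (power_series b (of_real t * iexp \<theta>)) - power_series b t)"
      proof (rule cSUP_upper)
        have "Re (power_series b (of_real t * iexp \<theta>)) - power_series b t \<le> 0" for \<theta>
          using Re_power_series_le[of b "of_real t * iexp \<theta>"] b t t' R by (simp add: norm_mult)
        then show "bdd_above ((\<lambda>\<theta>. Re (power_series b (of_real t * iexp \<theta>)) - power_series b t) `
            {\<theta>. h t \<le> \<bar>\<theta>\<bar> \<and> \<bar>\<theta>\<bar> \<le> pi})"
          by (intro bdd_aboveI2)
      qed (use \<phi> in auto)
      also have "\<dots> \<le> - V t * (h t)\<^sup>2"
        using tail[OF t(1,2), of "h t"] h[OF t' t(2)] hU[OF t(1,2)] by simp
      \<comment> \<open>Only the real part of the exponent enters the modulus, so the purely
        imaginary centering term disappears.\<close>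
      finally show ?thesis
        unfolding char[OF t' t(2)] norm_exp_eq_Re by (simp add: \<phi>_def)
    qed
    \<comment> \<open>The right endpoint lies in the range because h(t) < pi and \<sigma>(t) > 0, so
      this supremum too is over a nonempty set.\<close>
    have ne: "pi * \<sigma> t \<in> {\<theta>. h t * \<sigma> t \<le> \<bar>\<theta>\<bar> \<and> \<bar>\<theta>\<bar> \<le> pi * \<sigma> t}"
      if "t0 < t" "ereal t < R" "0 < \<sigma> t" for t
      using h[of t] that t0 by simp
    show "eventually (\<lambda>t. \<sigma> t * (SUP \<theta>\<in>{\<theta>. h t * \<sigma> t \<le> \<bar>\<theta>\<bar> \<and> \<bar>\<theta>\<bar> \<le> pi * \<sigma> t}.
        cmod (khinchin_char a t \<theta>)) \<le> sqrt (sigma_sq b t) * exp (- V t * (h t)\<^sup>2)) (at_upto R)"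
      using ev \<sigma>_pos
    proof eventually_elim
      case (elim t)
      have "(SUP \<theta>\<in>{\<theta>. h t * \<sigma> t \<le> \<bar>\<theta>\<bar> \<and> \<bar>\<theta>\<bar> \<le> pi * \<sigma> t}. cmod (khinchin_char a t \<theta>))
          \<le> exp (- V t * (h t)\<^sup>2)"
        by (rule cSUP_least) (use ne bound elim in blast)+
      then show ?case
        using \<sigma>[of t] elim t0 by (auto intro!: mult_left_mono)
    qed
    show "eventually (\<lambda>t. 0 \<le> \<sigma> t * (SUP \<theta>\<in>{\<theta>. h t * \<sigma> t \<le> \<bar>\<theta>\<bar> \<and> \<bar>\<theta>\<bar> \<le> pi * \<sigma> t}.
        cmod (khinchin_char a t \<theta>))) (at_upto R)"
      using ev \<sigma>_pos
    proof eventually_elim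
      case (elim t)
      have "0 \<le> (SUP \<theta>\<in>{\<theta>. h t * \<sigma> t \<le> \<bar>\<theta>\<bar> \<and> \<bar>\<theta>\<bar> \<le> pi * \<sigma> t}. cmod (khinchin_char a t \<theta>))"
      proof (rule cSUP_upper2)
        show "bdd_above ((\<lambda>\<theta>. cmod (khinchin_char a t \<theta>)) `
            {\<theta>. h t * \<sigma> t \<le> \<bar>\<theta>\<bar> \<and> \<bar>\<theta>\<bar> \<le> pi * \<sigma> t})"
          by (rule bdd_aboveI2) (use bound elim in blast)
        show "pi * \<sigma> t \<in> {\<theta>. h t * \<sigma> t \<le> \<bar>\<theta>\<bar> \<and> \<bar>\<theta>\<bar> \<le> pi * \<sigma> t}"
          using ne elim by blast
      qed simp
      then show ?case using elim by simp
    qed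
  qed simp
  have "hayman_coeffs a"
    unfolding hayman_coeffs_def Ra
  \<comment> \<open>The given \<open>h\<close> itself separates the two ranges of \<theta>.\<close>
  proof (intro conjI exI[of _ h])
    show "\<forall>t\<ge>0. ereal t < R \<longrightarrow> 0 < h t \<and> h t \<le> pi"
      using h by (auto intro: less_imp_le)
  qed (use a major minor \<sigma>_top in \<open>simp_all add: \<sigma>_def\<close>)
  then show ?thesis
    unfolding hayman_class_def using fz Ra by blast
qed

end
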